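(* Let $u,v\in\ell^+$ and $A\in[0,\infty)$. Set $w_k=ku_k$ for each $k$. Consider the statements \begin{align*} (1)\quad &\|C^*x\|_{\ell^\infty(v)}\le A\|Cx\|_{\ell^\infty(1/u)}\quad\text{for all } x\in\mathcal D(C^* );\\ (2)\quad &\|(C^*-S)Dz\|_{\ell^\infty(v)}\le A\|z\|_{\ell^\infty(1/w)}\quad\text{for all } z\in\mathcal D(C^*D) \text{ with } (Dz)_n\to0;\\ (3)\quad &\|C^*x\|_{\ell^\infty(v)}\le A\|Cx\|_{\ell^\infty(1/u)}\quad\text{for all } x\in\ell^+\cap\mathcal D(C^* );\\ (4)\quad &\|(C^*-S)Dz\|_{\ell^\infty(v)}\le A\|z\|_{\ell^\infty(1/w)}\quad\text{for all } z\in\ell^\uparrow\cap\mathcal D(C^*D) \text{ with } (Dz)_n\to0. \end{align*} Then (1) holds if and only if (2) holds, and (3) holds if and only if (4) holds.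
   Context: $\ell$ is the set of all real sequences indexed by the positive integers, $\ell^+$ the set of nonnegative real sequences, $\ell^\uparrow$ the set of nondecreasing sequences of nonnegative real numbers. $(Cx)_n=\frac1n\sum_{k=1}^n x_k$; $(C^*x)_n=\sum_{k=n}^\infty \frac{x_k}{k}$, with domain $\mathcal D(C^* )$ the set of all $x\in\ell$ for which $\sum_{k=1}^\infty \frac{x_k}{k}$ converges (possibly conditionally) in $\mathbb R$; $(Dz)_n=z_n/(n+1)$; $S$ is the right shift, $(Sy)_1=0$ and $(Sy)_n=y_{n-1}$ for $n\ge2$. $\mathcal D(C^*D)$ is the set of $z\in\ell$ for which $\sum_{k=1}^\infty\frac{z_k}{k(k+1)}$ converges in $\mathbb R$. Thus $((C^*-S)Dz)_n=\sum_{k=n}^\infty\frac{z_k}{k(k+1)}-\frac{z_{n-1}}{n}$ with $z_0=0$. For $u,v\in\ell^+$ and real sequences $x,y$: $\|y\|_{\ell^\infty(v)}=\sup_n|y_n|v_n\in[0,\infty]$ and $\|x\|_{\ell^\infty(1/u)}=\sup_k|x_k|/u_k\in[0,\infty]$, where, if $u_k=0$, $|x_k|/u_k$ is $0$ when $x_k=0$ and $\infty$ when $x_k\neq0$. An inequality of the form $\|\cdot\|\le A\|\cdot\|$ is regarded as holding whenever the norm on the right-hand side is $\infty$ (even if $A=0$). *)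

theory Defs
  imports "HOL-Analysis.Analysis"
begin

text \<open>
  Real sequences indexed by the positive integers are represented by functions
  \<^typ>\<open>nat \<Rightarrow> real\<close> whose value at \<open>0\<close> is irrelevant: no notion below, evaluated at
  positive indices, ever inspects it. Hence the space of all sequences is the whole type.
\<close>

definition ell_plus :: "(nat \<Rightarrow> real) set" where
  "ell_plus = {x. \<forall>n\<ge>1. 0 \<le> x n}"

definition ell_up :: "(nat \<Rightarrow> real) set" where
  "ell_up = {x. (\<forall>n\<ge>1. 0 \<le> x n) \<and> mono_on {1..} x}"

definition C :: "(nat \<Rightarrow> real) \<Rightarrow> nat \<Rightarrow> real" where
  "C x n = 1 / real n * (\<Sum>k=1..n. x k)"

text \<open>
  \<^const>\<open>summable\<close> and \<^const>\<open>suminf\<close> refer to limits of partial sums, so conditional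
  convergence is included. The summation index is shifted to start at \<open>0\<close>.
\<close>

definition dom_Cstar :: "(nat \<Rightarrow> real) set" where
  "dom_Cstar = {x. summable (\<lambda>j. x (1 + j) / real (1 + j))}"

definition Cstar :: "(nat \<Rightarrow> real) \<Rightarrow> nat \<Rightarrow> real" where
  "Cstar x n = (\<Sum>j. x (n + j) / real (n + j))"

definition D :: "(nat \<Rightarrow> real) \<Rightarrow> nat \<Rightarrow> real" where
  "D z n = z n / (real n + 1)"

definition S :: "(nat \<Rightarrow> real) \<Rightarrow> nat \<Rightarrow> real" where
  "S y n = (if n \<le> 1 then 0 else y (n - 1))"

definition dom_CstarD :: "(nat \<Rightarrow> real) set" where
  "dom_CstarD = {z. summable (\<lambda>j. z (1 + j) / (real (1 + j) * (real (1 + j) + 1)))}"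

definition CstarSD :: "(nat \<Rightarrow> real) \<Rightarrow> nat \<Rightarrow> real" where
  "CstarSD z n = Cstar (D z) n - S (D z) n"

definition norm_inf :: "(nat \<Rightarrow> real) \<Rightarrow> (nat \<Rightarrow> real) \<Rightarrow> ennreal" where
  "norm_inf v y = (SUP n\<in>{1..}. ennreal (\<bar>y n\<bar> * v n))"

definition norm_inf_inv :: "(nat \<Rightarrow> real) \<Rightarrow> (nat \<Rightarrow> real) \<Rightarrow> ennreal" where
  "norm_inf_inv u x = (SUP k\<in>{1..}.
     if u k = 0 then (if x k = 0 then 0 else \<infinity>) else ennreal (\<bar>x k\<bar> / u k))"

text \<open>
  The inequality \<open>a \<le> A b\<close>, regarded as true when \<open>b = \<infinity>\<close>. The first disjunct only matters
  for \<open>A = 0\<close>, because \<open>0 * \<infinity> = 0\<close> in \<^typ>\<open>ennreal\<close>.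
\<close>

definition norm_le :: "ennreal \<Rightarrow> real \<Rightarrow> ennreal \<Rightarrow> bool" where
  "norm_le a A b \<longleftrightarrow> b = \<infinity> \<or> a \<le> ennreal A * b"

lemma dom_CstarD_iff: "z \<in> dom_CstarD \<longleftrightarrow> D z \<in> dom_Cstar"
  by (simp add: dom_CstarD_def dom_Cstar_def D_def mult.commute)

lemma CstarSD_eq:
  assumes "n \<ge> 1"
  shows "CstarSD z n = (\<Sum>j. z (n + j) / (real (n + j) * (real (n + j) + 1)))
           - (if n = 1 then 0 else z (n - 1) / real n)"
  using assms by (auto simp: CstarSD_def Cstar_def D_def S_def mult.commute of_nat_diff)

end

theory Submission
  imports Defs
begin

text \<open>
  The two families of inequalities are the same under the change of variables
  \<open>z\<^sub>n = x\<^sub>1 + \<dots> + x\<^sub>n\<close>, inverted by \<open>x = z - S z\<close>. It carries nonnegative sequences to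
  nondecreasing nonnegative ones (lemma \<open>nonneg_iff_partial_sums_ell_up\<close>), and since
  \<open>(C x)\<^sub>n = z\<^sub>n / n\<close>, it turns the weight \<open>1/u\<close> on \<open>C x\<close> into the weight \<open>1/w\<close> on \<open>z\<close>
  (lemma \<open>norm_mean_eq_norm_partial_sums\<close>).

  For the left-hand sides, summation by parts gives
  \<open>\<Sum>\<^bsub>k=n\<^esub>\<^bsup>N\<^esup> x\<^sub>k / k = \<Sum>\<^bsub>k=n\<^esub>\<^bsup>N\<^esup> z\<^sub>k / (k(k+1)) - z\<^bsub>n-1\<^esub> / n + z\<^sub>N / (N+1)\<close>.
  If the boundary term \<open>z\<^sub>N / (N+1)\<close> tends to \<open>0\<close>, then the two series converge together and
  \<open>C\<^sup>* x = (C\<^sup>* - S) D z\<close>. The one fact that is not formal is that the boundary term does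
  vanish whenever \<open>\<Sum> x\<^sub>k / k\<close> converges, even conditionally: this is Kronecker's lemma, here a
  consequence of the regularity of Cesaro means. Hence \<open>\<D>(C\<^sup>*)\<close> corresponds exactly to the
  \<open>z \<in> \<D>(C\<^sup>*D)\<close> with \<open>D z \<longlonglongrightarrow> 0\<close> (lemma \<open>dom_Cstar_iff_partial_sums\<close>).
\<close>

text \<open>
  Regularity of Cesaro means at limit \<open>0\<close>: beyond an index \<open>M\<close> every term is below \<open>e/2\<close>, and the
  fixed initial sum is killed by the factor \<open>1/N\<close>.
\<close>

lemma cesaro_mean_tendsto_0:
  fixes a :: "nat \<Rightarrow> real"
  assumes "a \<longlonglongrightarrow> 0"
  shows "(\<lambda>N. (\<Sum>j<N. a j) / real N) \<longlonglongrightarrow> 0"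
proof (rule LIMSEQ_I)
  fix e :: real assume "0 < e"
  then obtain M where M: "\<And>j. j \<ge> M \<Longrightarrow> \<bar>a j\<bar> < e / 2"
    using LIMSEQ_D[OF assms, of "e / 2"] by auto
  define K where "K = (\<Sum>j<M. \<bar>a j\<bar>)"
  obtain P :: nat where P: "2 * K / e < real P"
    using reals_Archimedean2 by blast
  show "\<exists>no. \<forall>N\<ge>no. norm ((\<Sum>j<N. a j) / real N - 0) < e"
  proof (intro exI allI impI)
    fix N assume N: "N \<ge> Suc (max M P)"
    have "(\<Sum>j<N. \<bar>a j\<bar>) = K + (\<Sum>j=M..<N. \<bar>a j\<bar>)"
      unfolding K_def lessThan_atLeast0 using N by (subst sum.atLeastLessThan_concat) auto
    also have "(\<Sum>j=M..<N. \<bar>a j\<bar>) \<le> (\<Sum>j=M..<N. e / 2)"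
      using M by (intro sum_mono) (auto intro: less_imp_le)
    also have "\<dots> \<le> real N * (e / 2)"
      using \<open>0 < e\<close> by (simp add: mult_right_mono)
    finally have "(\<Sum>j<N. \<bar>a j\<bar>) \<le> K + real N * (e / 2)" by simp
    moreover have "K < real N * (e / 2)"
    proof -
      have "2 * K / e < real N" using P N by linarith
      then show ?thesis using \<open>0 < e\<close> by (simp add: field_simps)
    qed
    moreover have "\<bar>\<Sum>j<N. a j\<bar> \<le> (\<Sum>j<N. \<bar>a j\<bar>)" by (rule sum_abs)
    ultimately have "\<bar>\<Sum>j<N. a j\<bar> < real N * (e / 2) + real N * (e / 2)" by linarith
    then have "\<bar>\<Sum>j<N. a j\<bar> < e * real N" by (simp add: field_simps)
    then show "norm ((\<Sum>j<N. a j) / real N - 0) < e"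
      using N by (simp add: field_simps)
  qed
qed

text \<open>
  Kronecker's lemma for the weights \<open>1/k\<close>. With the tails \<open>R\<^sub>k\<close> of the series one has
  \<open>x\<^sub>k = k (R\<^sub>k - R\<^bsub>k+1\<^esub>)\<close>, so Abel summation writes the mean of the \<open>x\<^sub>k\<close> as the mean of the tails
  minus one more tail; both tend to \<open>0\<close>.
\<close>

lemma kronecker:
  fixes x :: "nat \<Rightarrow> real"
  assumes "summable (\<lambda>j. x (Suc j) / real (Suc j))"
  shows "(\<lambda>N. (\<Sum>k=1..N. x k) / real N) \<longlonglongrightarrow> 0"
proof -
  define f where "f = (\<lambda>j. x (Suc j) / real (Suc j))"
  define R where "R k = suminf f - (\<Sum>j<k. f j)" for k
  have "summable f" using assms by (simp only: f_def)
  then have "(\<lambda>k. suminf f - (\<Sum>j<k. f j)) \<longlonglongrightarrow> suminf f - suminf f"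
    by (intro tendsto_intros summable_LIMSEQ)
  then have R0: "R \<longlonglongrightarrow> 0" by (simp add: R_def [abs_def])
  have x: "x (Suc k) = real (Suc k) * (R k - R (Suc k))" for k
    by (simp add: R_def f_def)
  have abel: "(\<Sum>k=1..N. x k) = (\<Sum>k<N. R k) - real N * R N" for N
    by (induction N) (auto simp: x algebra_simps)
  have "(\<lambda>N. (\<Sum>k<N. R k) / real N - R N) \<longlonglongrightarrow> 0 - 0"
    by (intro tendsto_diff cesaro_mean_tendsto_0 R0)
  moreover have "\<forall>\<^sub>F N in sequentially.
      (\<Sum>k<N. R k) / real N - R N = (\<Sum>k=1..N. x k) / real N"
    using eventually_gt_at_top[of 0] by eventually_elim (simp only: abel, simp add: field_simps)
  ultimately show ?thesis by (simp add: tendsto_cong)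
qed

text \<open>
  One step of the sum telescopes because
  \<open>(z\<^sub>k - z\<^bsub>k-1\<^esub>) / k = z\<^sub>k / (k(k+1)) - z\<^bsub>k-1\<^esub> / k + z\<^sub>k / (k+1)\<close>.
  The value \<open>z 0\<close> is arbitrary, so the term \<open>z\<^bsub>n-1\<^esub> / n\<close> has to appear as \<open>S (D z) n\<close>, which
  encodes the convention \<open>z\<^sub>0 = 0\<close>.
\<close>

lemma summation_by_parts:
  assumes z: "\<forall>n\<ge>1. z n = (\<Sum>k=1..n. x k)" and "1 \<le> n"
  shows "(\<Sum>j<m. x (n + j) / real (n + j))
       = (\<Sum>j<m. D z (n + j) / real (n + j)) - S (D z) n + S (D z) (n + m)"
proof (induction m)
  case 0
  then show ?case by simp
next
  case (Suc m)
  have x: "x (n + m) = z (n + m) - S z (n + m)"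
  proof (cases "n + m = 1")
    case True
    then show ?thesis by (simp add: S_def z)
  next
    case False
    with \<open>1 \<le> n\<close> obtain p where p: "n + m = Suc p" "1 \<le> p"
      by (cases "n + m") auto
    then show ?thesis by (simp add: S_def z)
  qed
  have S: "S (D z) (n + m) = S z (n + m) / real (n + m)"
    using \<open>1 \<le> n\<close> by (auto simp: S_def D_def of_nat_diff)
  have S': "S (D z) (Suc (n + m)) = D z (n + m)"
    using \<open>1 \<le> n\<close> by (simp add: S_def)
  define t where "t = real (n + m)"
  have "t > 0" using \<open>1 \<le> n\<close> by (simp add: t_def)
  then have "(z (n + m) - S z (n + m)) / t
      = z (n + m) / (t + 1) / t - S z (n + m) / t + z (n + m) / (t + 1)"
    by (simp add: divide_simps) (simp add: algebra_simps)
  then have "x (n + m) / real (n + m)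
      = D z (n + m) / real (n + m) - S (D z) (n + m) + S (D z) (Suc (n + m))"
    by (simp only: x S S' D_def t_def)
  then show ?case using Suc.IH by simp
qed

lemma summable_from:
  assumes "summable (\<lambda>j. f (1 + j))" and "1 \<le> n"
  shows "summable (\<lambda>j. f (n + j) :: real)"
  using summable_ignore_initial_segment[OF assms(1), of "n - 1"] \<open>1 \<le> n\<close>
  by (simp add: add.commute)

lemma shift_tendsto_0:
  assumes "y \<longlonglongrightarrow> 0" and "1 \<le> n"
  shows "(\<lambda>m. S y (n + m)) \<longlonglongrightarrow> 0"
proof (rule LIMSEQ_offset[of _ 1])
  have "(\<lambda>m. S y (n + (m + 1))) = (\<lambda>m. y (m + n))"
    using \<open>1 \<le> n\<close> by (auto simp: S_def add.commute)
  then show "(\<lambda>m. S y (n + (m + 1))) \<longlonglongrightarrow> 0"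
    using LIMSEQ_ignore_initial_segment[OF assms(1)] by simp
qed

lemma Cstar_sums_partial_sums:
  assumes z: "\<forall>n\<ge>1. z n = (\<Sum>k=1..n. x k)" and "1 \<le> n"
    and "z \<in> dom_CstarD" and "D z \<longlonglongrightarrow> 0"
  shows "(\<lambda>j. x (n + j) / real (n + j)) sums CstarSD z n"
proof -
  have "summable (\<lambda>j. D z (n + j) / real (n + j))"
    using assms(3) summable_from[of "\<lambda>k. D z k / real k", OF _ \<open>1 \<le> n\<close>]
    by (simp add: dom_CstarD_iff dom_Cstar_def)
  then have "(\<lambda>m. (\<Sum>j<m. D z (n + j) / real (n + j)) - S (D z) n + S (D z) (n + m))
      \<longlonglongrightarrow> Cstar (D z) n - S (D z) n + 0"
    unfolding Cstar_def using assms(2,4)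
    by (intro tendsto_intros summable_LIMSEQ shift_tendsto_0)
  then show ?thesis
    unfolding sums_def CstarSD_def summation_by_parts[OF z \<open>1 \<le> n\<close>] by simp
qed

text \<open>
  From left to right, Kronecker's lemma supplies \<open>D z \<longlonglongrightarrow> 0\<close>; only then can summation by parts
  be read backwards to get the convergence of \<open>\<Sum> z\<^sub>k / (k(k+1))\<close>.
\<close>

lemma dom_Cstar_iff_partial_sums:
  assumes z: "\<forall>n\<ge>1. z n = (\<Sum>k=1..n. x k)"
  shows "x \<in> dom_Cstar \<longleftrightarrow> z \<in> dom_CstarD \<and> D z \<longlonglongrightarrow> 0"
proof
  assume "x \<in> dom_Cstar"
  then have sum_x: "summable (\<lambda>j. x (1 + j) / real (1 + j))"
    by (simp add: dom_Cstar_def)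
  \<comment> \<open>Kronecker's lemma controls \<open>z\<^sub>N / N\<close>, whereas \<open>D\<close> divides by \<open>N + 1\<close>.\<close>
  have "(\<lambda>N. z N / real N * (real N / (real N + 1))) \<longlonglongrightarrow> 0 * 1"
  proof (intro tendsto_mult)
    have "(\<lambda>N. (\<Sum>k=1..N. x k) / real N) \<longlonglongrightarrow> 0"
      using sum_x by (intro kronecker) simp
    then show "(\<lambda>N. z N / real N) \<longlonglongrightarrow> 0"
      by (rule Lim_transform_eventually)
        (use eventually_ge_at_top[of 1] in \<open>eventually_elim, simp add: z\<close>)
    show "(\<lambda>N. real N / (real N + 1)) \<longlonglongrightarrow> 1"
      using LIMSEQ_n_over_Suc_n by (simp add: add.commute)
  qed
  then have D0: "D z \<longlonglongrightarrow> 0"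
    unfolding mult_zero_left
    by (rule Lim_transform_eventually)
      (use eventually_ge_at_top[of 1] in \<open>eventually_elim, simp add: D_def\<close>)
  have "(\<lambda>m. (\<Sum>j<m. x (1 + j) / real (1 + j)) - S (D z) (1 + m))
      \<longlonglongrightarrow> (\<Sum>j. x (1 + j) / real (1 + j)) - 0"
    using D0 sum_x by (intro tendsto_intros summable_LIMSEQ shift_tendsto_0) auto
  moreover have "(\<Sum>j<m. x (1 + j) / real (1 + j)) - S (D z) (1 + m)
      = (\<Sum>j<m. D z (1 + j) / real (1 + j))" for m
    unfolding summation_by_parts[OF z order_refl] by (simp add: S_def)
  ultimately have "D z \<in> dom_Cstar"
    by (auto simp: dom_Cstar_def summable_def sums_def)
  with D0 show "z \<in> dom_CstarD \<and> D z \<longlonglongrightarrow> 0"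
    by (simp add: dom_CstarD_iff)
next
  assume "z \<in> dom_CstarD \<and> D z \<longlonglongrightarrow> 0"
  then show "x \<in> dom_Cstar"
    using Cstar_sums_partial_sums[OF z order_refl]
    by (auto simp: dom_Cstar_def dest: sums_summable)
qed

lemma norm_Cstar_eq_norm_CstarSD:
  assumes z: "\<forall>n\<ge>1. z n = (\<Sum>k=1..n. x k)" and "x \<in> dom_Cstar"
  shows "norm_inf v (Cstar x) = norm_inf v (CstarSD z)"
proof -
  have "Cstar x n = CstarSD z n" if "1 \<le> n" for n
    using Cstar_sums_partial_sums[OF z that] assms(2) dom_Cstar_iff_partial_sums[OF z]
    by (simp add: Cstar_def sums_iff)
  then show ?thesis
    by (auto simp: norm_inf_def intro!: SUP_cong)
qed

text \<open>
  The conventions for vanishing weights agree as well: at a positive index \<open>k\<close>, \<open>w\<^sub>k = 0\<close>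
  exactly when \<open>u\<^sub>k = 0\<close>, and \<open>z\<^sub>k = 0\<close> exactly when \<open>(C x)\<^sub>k = 0\<close>.
\<close>

lemma norm_mean_eq_norm_partial_sums:
  assumes z: "\<forall>n\<ge>1. z n = (\<Sum>k=1..n. x k)"
    and w: "\<forall>k\<ge>1. w k = real k * u k"
  shows "norm_inf_inv u (C x) = norm_inf_inv w z"
proof -
  have "C x k = z k / real k" if "1 \<le> k" for k
    using that by (simp add: C_def z)
  then show ?thesis
    by (auto simp: norm_inf_inv_def w intro!: SUP_cong)
qed

lemma nonneg_iff_partial_sums_ell_up:
  assumes z: "\<forall>n\<ge>1. z n = (\<Sum>k=1..n. x k)"
  shows "x \<in> ell_plus \<longleftrightarrow> z \<in> ell_up"
proof
  assume "x \<in> ell_plus"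
  then have x: "0 \<le> x k" if "1 \<le> k" for k using that by (simp add: ell_plus_def)
  have "mono_on {1..} z"
    by (rule mono_onI) (auto simp: z intro!: sum_mono2 x)
  then show "z \<in> ell_up"
    by (auto simp: ell_up_def z intro!: sum_nonneg x)
next
  assume up: "z \<in> ell_up"
  have "0 \<le> x k" if k: "1 \<le> k" for k
  proof (cases "k = 1")
    case True
    then show ?thesis using up z by (auto simp: ell_up_def dest: spec[of _ 1])
  next
    case False
    with k obtain p where p: "k = Suc p" "1 \<le> p" by (cases k) auto
    then have "z p \<le> z (Suc p)"
      using up by (auto simp: ell_up_def intro: mono_onD)
    with p show ?thesis by (simp add: z)
  qed
  then show "x \<in> ell_plus" by (simp add: ell_plus_def)
qed

lemma partial_sums_of_differences:
  "\<forall>n\<ge>1. z n = (\<Sum>k=1..n. z k - S z k)"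
proof (intro allI impI)
  fix n :: nat assume "1 \<le> n"
  then show "z n = (\<Sum>k=1..n. z k - S z k)"
    by (induction n rule: dec_induct) (auto simp: S_def)
qed

theorem theorem2p4:
  fixes u v w :: "nat \<Rightarrow> real" and A :: real
  assumes "u \<in> ell_plus" and "v \<in> ell_plus" and "0 \<le> A"
    and "\<forall>k\<ge>1. w k = real k * u k"
  shows
    "((\<forall>x\<in>dom_Cstar. norm_le (norm_inf v (Cstar x)) A (norm_inf_inv u (C x)))
      \<longleftrightarrow>
      (\<forall>z\<in>dom_CstarD. D z \<longlonglongrightarrow> 0 \<longrightarrow>
         norm_le (norm_inf v (CstarSD z)) A (norm_inf_inv w z)))
    \<and>
     ((\<forall>x\<in>ell_plus \<inter> dom_Cstar. norm_le (norm_inf v (Cstar x)) A (norm_inf_inv u (C x)))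
      \<longleftrightarrow>
      (\<forall>z\<in>ell_up \<inter> dom_CstarD. D z \<longlonglongrightarrow> 0 \<longrightarrow>
         norm_le (norm_inf v (CstarSD z)) A (norm_inf_inv w z)))"
proof -
  let ?P = "\<lambda>x. norm_le (norm_inf v (Cstar x)) A (norm_inf_inv u (C x))"
  let ?Q = "\<lambda>z. norm_le (norm_inf v (CstarSD z)) A (norm_inf_inv w z)"
  have corr: "(x \<in> dom_Cstar \<longleftrightarrow> z \<in> dom_CstarD \<and> D z \<longlonglongrightarrow> 0) \<and>
      (x \<in> ell_plus \<longleftrightarrow> z \<in> ell_up) \<and> (x \<in> dom_Cstar \<longrightarrow> ?P x = ?Q z)"
    if z: "\<forall>n\<ge>1. z n = (\<Sum>k=1..n. x k)" for x z
    using dom_Cstar_iff_partial_sums[OF z] nonneg_iff_partial_sums_ell_up[OF z]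
      norm_Cstar_eq_norm_CstarSD[OF z] norm_mean_eq_norm_partial_sums[OF z assms(4)]
    by simp
  have to_z: "\<exists>z. (x \<in> dom_Cstar \<longleftrightarrow> z \<in> dom_CstarD \<and> D z \<longlonglongrightarrow> 0) \<and>
      (x \<in> ell_plus \<longleftrightarrow> z \<in> ell_up) \<and> (x \<in> dom_Cstar \<longrightarrow> ?P x = ?Q z)" for x
    by (rule exI[of _ "\<lambda>n. \<Sum>k=1..n. x k"], rule corr) simp
  have to_x: "\<exists>x. (x \<in> dom_Cstar \<longleftrightarrow> z \<in> dom_CstarD \<and> D z \<longlonglongrightarrow> 0) \<and>
      (x \<in> ell_plus \<longleftrightarrow> z \<in> ell_up) \<and> (x \<in> dom_Cstar \<longrightarrow> ?P x = ?Q z)" for z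
    by (rule exI, rule corr) (rule partial_sums_of_differences)
  show ?thesis
  proof (intro conjI iffI ballI impI)
    fix z assume "\<forall>x\<in>dom_Cstar. ?P x" "z \<in> dom_CstarD" "D z \<longlonglongrightarrow> 0"
    then show "?Q z" using to_x[of z] by blast
  next
    fix x assume "\<forall>z\<in>dom_CstarD. D z \<longlonglongrightarrow> 0 \<longrightarrow> ?Q z" "x \<in> dom_Cstar"
    then show "?P x" using to_z[of x] by blast
  next
    fix z assume "\<forall>x\<in>ell_plus \<inter> dom_Cstar. ?P x" "z \<in> ell_up \<inter> dom_CstarD" "D z \<longlonglongrightarrow> 0"
    then show "?Q z" using to_x[of z] by blast
  next
    fix x assume "\<forall>z\<in>ell_up \<inter> dom_CstarD. D z \<longlonglongrightarrow> 0 \<longrightarrow> ?Q z" "x \<in> ell_plus \<inter> dom_Cstar"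
    then show "?P x" using to_z[of x] by blast
  qed
qed

end
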